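(* The quadratic form $x^2 + iy^2 + z^2 + iw^2$ is universal over $\mathbb{Z}[i]$; that is, for every $g \in \mathbb{Z}[i]$ there exist $x, y, z, w \in \mathbb{Z}[i]$ such that $x^2 + iy^2 + z^2 + iw^2 = g$.
   Context: $\mathbb{Z}[i]$ is the ring of Gaussian integers, with $i^2 = -1$. A form with Gaussian integer coefficients in Gaussian integer variables is called universal over $\mathbb{Z}[i]$ if it represents all Gaussian integers. *)

theory Defs
  imports "HOL-Analysis.Analysis"
begin

definition gaussian_ints :: "complex set" where
  "gaussian_ints = {of_int a + \<i> * of_int b | a b :: int. True}"

(* The sum runs over ordered pairs, so the coefficient of the monomial v$j * v$k with j \<noteq> k is
   a j k + a k j, an arbitrary Gaussian integer (no evenness of mixed coefficients is imposed). *)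
definition gaussian_quadratic_form :: "(complex ^ 'n::finite \<Rightarrow> complex) \<Rightarrow> bool" where
  "gaussian_quadratic_form Q \<longleftrightarrow>
     (\<exists>a :: 'n \<Rightarrow> 'n \<Rightarrow> complex. (\<forall>j k. a j k \<in> gaussian_ints) \<and>
        (\<forall>v. Q v = (\<Sum>j\<in>UNIV. \<Sum>k\<in>UNIV. a j k * (v $ j) * (v $ k))))"

definition universal_gaussian_form :: "(complex ^ 'n::finite \<Rightarrow> complex) \<Rightarrow> bool" where
  "universal_gaussian_form Q \<longleftrightarrow>
     gaussian_quadratic_form Q \<and>
     (\<forall>g\<in>gaussian_ints. \<exists>v. (\<forall>j. v $ j \<in> gaussian_ints) \<and> Q v = g)"

end

theory Submission
  imports Defs
begin

text \<open>
  The form is \<open>s + i t\<close> with \<open>s = x\<^sup>2 + z\<^sup>2\<close> and \<open>t = y\<^sup>2 + w\<^sup>2\<close>, so the question is which Gaussian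
  integers are sums of two squares. Over the Gaussian integers such a sum factors as
  \<open>x\<^sup>2 + z\<^sup>2 = (x + i z) (x - i z)\<close>, and the two factors can be any \<open>u\<close>, \<open>v\<close> with \<open>u \<equiv> v\<close> modulo 2.
  Choosing \<open>u\<close> to be \<open>1\<close>, \<open>1 + i\<close> or \<open>2\<close> and letting \<open>v\<close> run shows that whole residue classes are
  sums of two squares: \<open>1\<close> modulo 2, and \<open>0\<close>, \<open>2\<close>, \<open>2 i\<close> modulo 4. Multiplication by \<open>i\<close> turns the
  classes of \<open>1\<close> modulo 2 and of \<open>2\<close> modulo 4 into those of \<open>i\<close> modulo 2 and of \<open>2 i\<close> modulo 4, so
  \<open>i t\<close> can be anything in these. The only classes not yet covered, \<open>1 + i\<close> modulo 2 and \<open>2 + 2 i\<close>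
  modulo 4, are then reached by adding \<open>s = 1\<close> and \<open>s = 2\<close> respectively.
\<close>

lemma gaussian_ints_of_int: "of_int a \<in> gaussian_ints"
  unfolding gaussian_ints_def by (rule CollectI, rule exI[of _ a], rule exI[of _ 0]) simp

lemma gaussian_ints_0: "0 \<in> gaussian_ints"
  using gaussian_ints_of_int[of 0] by simp

lemma gaussian_ints_1: "1 \<in> gaussian_ints"
  using gaussian_ints_of_int[of 1] by simp

lemma gaussian_ints_ii: "\<i> \<in> gaussian_ints"
  unfolding gaussian_ints_def by (rule CollectI, rule exI[of _ 0], rule exI[of _ 1]) simp

lemma gaussian_ints_add:
  assumes "x \<in> gaussian_ints" "y \<in> gaussian_ints"
  shows "x + y \<in> gaussian_ints"
proof -
  obtain a b c d :: int where "x = of_int a + \<i> * of_int b" "y = of_int c + \<i> * of_int d"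
    using assms unfolding gaussian_ints_def by blast
  then have "x + y = of_int (a + c) + \<i> * of_int (b + d)"
    by (simp add: algebra_simps)
  then show ?thesis unfolding gaussian_ints_def by blast
qed

lemma gaussian_ints_mult:
  assumes "x \<in> gaussian_ints" "y \<in> gaussian_ints"
  shows "x * y \<in> gaussian_ints"
proof -
  obtain a b c d :: int where "x = of_int a + \<i> * of_int b" "y = of_int c + \<i> * of_int d"
    using assms unfolding gaussian_ints_def by blast
  then have "x * y = of_int (a * c - b * d) + \<i> * of_int (a * d + b * c)"
    by (simp add: complex_eq_iff algebra_simps)
  then show ?thesis unfolding gaussian_ints_def by blast
qed

lemma gaussian_ints_uminus: "x \<in> gaussian_ints \<Longrightarrow> - x \<in> gaussian_ints"
  using gaussian_ints_mult[OF gaussian_ints_of_int[of "-1"]] by simp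

lemma gaussian_ints_diff:
  "x \<in> gaussian_ints \<Longrightarrow> y \<in> gaussian_ints \<Longrightarrow> x - y \<in> gaussian_ints"
  using gaussian_ints_add[OF _ gaussian_ints_uminus] by fastforce

lemmas gaussian_ints_intros =
  gaussian_ints_0 gaussian_ints_1 gaussian_ints_ii gaussian_ints_add gaussian_ints_mult
  gaussian_ints_uminus gaussian_ints_diff

lemma gaussian_ints_mod_2_cases:
  assumes "g \<in> gaussian_ints"
  obtains m where "m \<in> gaussian_ints"
    and "g = 2 * m \<or> g = 2 * m + 1 \<or> g = 2 * m + \<i> \<or> g = 2 * m + 1 + \<i>"
proof -
  obtain a b :: int where g: "g = of_int a + \<i> * of_int b"
    using assms unfolding gaussian_ints_def by blast
  define m :: complex where "m = of_int (a div 2) + \<i> * of_int (b div 2)"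
  have "m \<in> gaussian_ints"
    unfolding m_def gaussian_ints_def by blast
  moreover have "g = 2 * m + of_int (a mod 2) + \<i> * of_int (b mod 2)"
  proof -
    have "(of_int n :: complex) = 2 * of_int (n div 2) + of_int (n mod 2)" for n :: int
      by (metis mult_div_mod_eq of_int_add of_int_mult of_int_numeral)
    from this[of a] this[of b] show ?thesis
      unfolding g m_def by (simp add: algebra_simps)
  qed
  moreover have "a mod 2 = 0 \<or> a mod 2 = 1" "b mod 2 = 0 \<or> b mod 2 = 1"
    by presburger+
  ultimately show thesis
    by (intro that[of m]) auto
qed

definition gaussian_two_square_sums :: "complex set" where
  "gaussian_two_square_sums = {x\<^sup>2 + z\<^sup>2 | x z. x \<in> gaussian_ints \<and> z \<in> gaussian_ints}"

text \<open>
  The usual factorization is used backwards: \<open>u v = ((u + v) / 2)\<^sup>2 + ((u - v) / (2 i))\<^sup>2\<close>, where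
  writing \<open>v = u + 2 k\<close> removes the denominators.
\<close>

lemma gaussian_two_square_sums_product:
  assumes "u \<in> gaussian_ints" "k \<in> gaussian_ints"
  shows "u * (u + 2 * k) \<in> gaussian_two_square_sums"
proof -
  have "u * (u + 2 * k) = (u + k)\<^sup>2 + (\<i> * k)\<^sup>2"
    by (simp add: power2_eq_square algebra_simps)
  moreover have "u + k \<in> gaussian_ints" "\<i> * k \<in> gaussian_ints"
    using assms by (auto intro!: gaussian_ints_intros)
  ultimately show ?thesis
    unfolding gaussian_two_square_sums_def by blast
qed

lemma gaussian_two_square_sums_1_mod_2:
  assumes "m \<in> gaussian_ints"
  shows "2 * m + 1 \<in> gaussian_two_square_sums"
  using gaussian_two_square_sums_product[OF gaussian_ints_1 assms] by (simp add: add.commute)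

lemma gaussian_two_square_sums_0_mod_4:
  assumes "m \<in> gaussian_ints"
  shows "4 * m \<in> gaussian_two_square_sums"
proof -
  have "(1 + 1) * ((1 + 1) + 2 * (m - 1)) \<in> gaussian_two_square_sums"
    using assms by (intro gaussian_two_square_sums_product gaussian_ints_intros)
  moreover have "(1 + 1) * ((1 + 1) + 2 * (m - 1)) = 4 * m"
    by (simp add: algebra_simps)
  ultimately show ?thesis by (simp only:)
qed

text \<open>
  With \<open>u = 1 + i\<close> the product is \<open>2 i + 2 (1 + i) k\<close>; since \<open>4 = 2 (1 + i) (1 - i)\<close> and
  \<open>2 - 2 i = - 2 i (1 + i)\<close>, this covers both of the following classes modulo 4.
\<close>

lemma gaussian_two_square_sums_2i_mod_4:
  assumes "m \<in> gaussian_ints"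
  shows "4 * m + 2 * \<i> \<in> gaussian_two_square_sums"
proof -
  have "(1 + \<i>) * ((1 + \<i>) + 2 * ((1 - \<i>) * m)) = 4 * m + 2 * \<i>"
    by (simp add: algebra_simps)
  then show ?thesis
    using gaussian_two_square_sums_product[of "1 + \<i>" "(1 - \<i>) * m"] assms
    by (simp add: gaussian_ints_intros)
qed

lemma gaussian_two_square_sums_2_mod_4:
  assumes "m \<in> gaussian_ints"
  shows "4 * m + 2 \<in> gaussian_two_square_sums"
proof -
  have "(1 + \<i>) * ((1 + \<i>) + 2 * ((1 - \<i>) * m - \<i>)) = 4 * m + 2"
    by (simp add: algebra_simps)
  then show ?thesis
    using gaussian_two_square_sums_product[of "1 + \<i>" "(1 - \<i>) * m - \<i>"] assms
    by (simp add: gaussian_ints_intros)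
qed

text \<open>
  If a coordinate of \<open>g\<close> is odd, its class modulo 2 decides how to split it. If \<open>g = 2 m\<close>, the
  parities of the coordinates of \<open>m\<close> give the class of \<open>g\<close> modulo 4, and this class decides.
\<close>

lemma gaussian_int_two_square_sums_decomposition:
  assumes "g \<in> gaussian_ints"
  obtains s t where "s \<in> gaussian_two_square_sums" "t \<in> gaussian_two_square_sums" "g = s + \<i> * t"
proof -
  have zero: "0 \<in> gaussian_two_square_sums"
    using gaussian_two_square_sums_0_mod_4[OF gaussian_ints_0] by simp
  have one: "1 \<in> gaussian_two_square_sums"
    using gaussian_two_square_sums_1_mod_2[OF gaussian_ints_0] by simp
  have two: "2 \<in> gaussian_two_square_sums"
    using gaussian_two_square_sums_2_mod_4[OF gaussian_ints_0] by simp
  obtain m where m: "m \<in> gaussian_ints"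
    and g: "g = 2 * m \<or> g = 2 * m + 1 \<or> g = 2 * m + \<i> \<or> g = 2 * m + 1 + \<i>"
    using gaussian_ints_mod_2_cases[OF assms] .
  have i_class: "2 * (- \<i> * m) + 1 \<in> gaussian_two_square_sums"
    using m by (intro gaussian_two_square_sums_1_mod_2 gaussian_ints_intros)
  from g consider "g = 2 * m" | "g = 2 * m + 1" | "g = 2 * m + \<i>" | "g = 2 * m + 1 + \<i>"
    by blast
  then show thesis
  proof cases
    case 1
    obtain n where n: "n \<in> gaussian_ints"
      and "m = 2 * n \<or> m = 2 * n + 1 \<or> m = 2 * n + \<i> \<or> m = 2 * n + 1 + \<i>"
      using gaussian_ints_mod_2_cases[OF m] .
    then consider "m = 2 * n" | "m = 2 * n + 1" | "m = 2 * n + \<i>" | "m = 2 * n + 1 + \<i>"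
      by blast
    then show thesis
    proof cases
      case 1
      show thesis
        by (rule that[OF gaussian_two_square_sums_0_mod_4[OF n] zero])
          (simp add: 1 \<open>g = 2 * m\<close>)
    next
      case 2
      show thesis
        by (rule that[OF gaussian_two_square_sums_2_mod_4[OF n] zero])
          (simp add: 2 \<open>g = 2 * m\<close>)
    next
      case 3
      show thesis
        by (rule that[OF gaussian_two_square_sums_2i_mod_4[OF n] zero])
          (simp add: 3 \<open>g = 2 * m\<close>)
    next
      case 4
      have "4 * (- \<i> * n) + 2 \<in> gaussian_two_square_sums"
        using n by (intro gaussian_two_square_sums_2_mod_4 gaussian_ints_intros)
      then show thesis
        by (rule that[OF two]) (simp add: 4 \<open>g = 2 * m\<close> algebra_simps)
    qed
  next
    case 2
    show thesis
      by (rule that[OF gaussian_two_square_sums_1_mod_2[OF m] zero]) (simp add: 2)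
  next
    case 3
    show thesis
      by (rule that[OF zero i_class]) (simp add: 3 algebra_simps)
  next
    case 4
    show thesis
      by (rule that[OF one i_class]) (simp add: 4 algebra_simps)
  qed
qed

lemma gaussian_int_representation:
  assumes "g \<in> gaussian_ints"
  shows "\<exists>x\<in>gaussian_ints. \<exists>y\<in>gaussian_ints. \<exists>z\<in>gaussian_ints. \<exists>w\<in>gaussian_ints.
           x\<^sup>2 + \<i> * y\<^sup>2 + z\<^sup>2 + \<i> * w\<^sup>2 = g"
proof -
  obtain s t where "s \<in> gaussian_two_square_sums" "t \<in> gaussian_two_square_sums"
    and g: "g = s + \<i> * t"
    using gaussian_int_two_square_sums_decomposition[OF assms] .
  then obtain x y z w where mem: "x \<in> gaussian_ints" "y \<in> gaussian_ints"
      "z \<in> gaussian_ints" "w \<in> gaussian_ints"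
    and "s = x\<^sup>2 + z\<^sup>2" "t = y\<^sup>2 + w\<^sup>2"
    unfolding gaussian_two_square_sums_def by blast
  then have "x\<^sup>2 + \<i> * y\<^sup>2 + z\<^sup>2 + \<i> * w\<^sup>2 = g"
    using g by (simp add: algebra_simps)
  with mem show ?thesis by blast
qed

lemma gaussian_quadratic_form_diagonal:
  fixes c :: "'n::finite \<Rightarrow> complex"
  assumes "\<And>j. c j \<in> gaussian_ints"
  shows "gaussian_quadratic_form (\<lambda>v. \<Sum>j\<in>UNIV. c j * (v $ j)\<^sup>2)"
proof -
  have "(\<Sum>k\<in>UNIV. (if k = j then c j else 0) * v $ j * v $ k) = c j * (v $ j)\<^sup>2"
    for j and v :: "complex ^ 'n"
  proof -
    have "(\<Sum>k\<in>UNIV. (if k = j then c j else 0) * v $ j * v $ k)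
        = (\<Sum>k\<in>UNIV. if k = j then c j * v $ j * v $ k else 0)"
      by (rule sum.cong) auto
    then show ?thesis
      by (simp add: power2_eq_square mult.assoc)
  qed
  then show ?thesis
    unfolding gaussian_quadratic_form_def using assms gaussian_ints_0
    by (intro exI[of _ "\<lambda>j k. if k = j then c j else 0"]) simp
qed

theorem theorem4:
  shows "universal_gaussian_form
           (\<lambda>v :: complex ^ 4. (v $ 1)\<^sup>2 + \<i> * (v $ 2)\<^sup>2 + (v $ 3)\<^sup>2 + \<i> * (v $ 4)\<^sup>2)
         \<and> (\<forall>g\<in>gaussian_ints. \<exists>x\<in>gaussian_ints. \<exists>y\<in>gaussian_ints. \<exists>z\<in>gaussian_ints. \<exists>w\<in>gaussian_ints.
              x\<^sup>2 + \<i> * y\<^sup>2 + z\<^sup>2 + \<i> * w\<^sup>2 = g)"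
proof
  let ?Q = "\<lambda>v :: complex ^ 4. (v $ 1)\<^sup>2 + \<i> * (v $ 2)\<^sup>2 + (v $ 3)\<^sup>2 + \<i> * (v $ 4)\<^sup>2"
  define c :: "4 \<Rightarrow> complex" where "c j = (if j = 1 \<or> j = 3 then 1 else \<i>)" for j
  have "gaussian_quadratic_form (\<lambda>v. \<Sum>j\<in>UNIV. c j * (v $ j)\<^sup>2)"
    by (rule gaussian_quadratic_form_diagonal) (simp add: c_def gaussian_ints_1 gaussian_ints_ii)
  then have form: "gaussian_quadratic_form ?Q"
    by (simp add: sum_4 c_def)
  have represents: "\<exists>v. (\<forall>j. v $ j \<in> gaussian_ints) \<and> ?Q v = g" if g: "g \<in> gaussian_ints" for g
  proof -
    obtain x y z w where mem: "x \<in> gaussian_ints" "y \<in> gaussian_ints"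
        "z \<in> gaussian_ints" "w \<in> gaussian_ints"
      and eq: "x\<^sup>2 + \<i> * y\<^sup>2 + z\<^sup>2 + \<i> * w\<^sup>2 = g"
      using gaussian_int_representation[OF g] by blast
    define v :: "complex ^ 4" where "v = (\<chi> j. if j = 1 then x else if j = 2 then y else if j = 3 then z else w)"
    have v: "v $ 1 = x" "v $ 2 = y" "v $ 3 = z" "v $ 4 = w"
      unfolding v_def by simp_all
    then have "\<forall>j. v $ j \<in> gaussian_ints"
      using mem by (simp add: forall_4)
    moreover have "?Q v = g"
      using v eq by simp
    ultimately show ?thesis by blast
  qed
  show "universal_gaussian_form ?Q"
    unfolding universal_gaussian_form_def using form represents by blast
qed (use gaussian_int_representation in blast)

end
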